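(* Let $\nu>-1$, $t>0$, $0<\lambda<1$, $n\ge0$, and let $Q_n^\nu(x;t,\lambda)$ be the orthonormal polynomials with respect to the weight $\rho_{k+\nu+1}(\lambda t)\lambda^k/k!$, $k\in\mathbb{N}_0$, with three-term recurrence coefficients $q_n^\nu,h_n^\nu$. Then $$t\frac{\partial Q_n^\nu}{\partial t}(x;t,\lambda)-\lambda\frac{\partial Q_n^\nu}{\partial\lambda}(x;t,\lambda)-q_n^\nu Q_{n-1}^\nu(x;t,\lambda)=\frac{h_n^\nu}{2}Q_n^\nu(x;t,\lambda).$$
   Context: For $t>0$ and real $\mu$, $\rho_\mu(t)=2t^{\mu/2}K_\mu(2\sqrt t)$, where $K_\mu$ is the modified Bessel (Macdonald) function; for $\mu>0$, $\rho_\mu(t)=\int_0^\infty e^{-t/x-x}x^{\mu-1}dx$. The polynomials $Q_n^\nu(x;t,\lambda)=\alpha_n^\nu x^n+\beta_n^\nu x^{n-1}+\dots$ have real coefficients depending on $t,\lambda$, $\deg Q_n^\nu=n$, and satisfy $\sum_{k=0}^\infty Q_n^\nu(k;t,\lambda)Q_m^\nu(k;t,\lambda)\rho_{k+\nu+1}(\lambda t)\frac{\lambda^k}{k!}=\delta_{n,m}$ for all $n,m\in\mathbb{N}_0$. They satisfy $xQ_n^\nu=q_{n+1}^\nu Q_{n+1}^\nu+h_n^\nu Q_n^\nu+q_n^\nu Q_{n-1}^\nu$ with $q_n^\nu=\alpha_{n-1}^\nu/\alpha_n^\nu$, $h_n^\nu=\beta_n^\nu/\alpha_n^\nu-\beta_{n+1}^\nu/\alpha_{n+1}^\nu$;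 conventions: $Q_{-1}^\nu\equiv0$, $q_0^\nu=0$, $\beta_0^\nu=0$. Standing assumption: the coefficients of the $Q_n^\nu$ are $C^1$ functions of $(t,\lambda)$ for $t>0$, $0<\lambda<1$. *)

theory Defs
  imports "HOL-Analysis.Analysis" "HOL-Computational_Algebra.Polynomial"
begin

text \<open>The modified Bessel (Macdonald) function of real order, for \<open>z > 0\<close>, given by Schlaefli's
  integral, which covers integer and non-integer orders uniformly.\<close>

definition bessel_K :: "real \<Rightarrow> real \<Rightarrow> real" where
  "bessel_K \<mu> z = integral {0..} (\<lambda>u. exp (- z * cosh u) * cosh (\<mu> * u))"

definition rho :: "real \<Rightarrow> real \<Rightarrow> real" where
  "rho \<mu> t = 2 * t powr (\<mu> / 2) * bessel_K \<mu> (2 * sqrt t)"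

definition weight :: "real \<Rightarrow> real \<Rightarrow> real \<Rightarrow> nat \<Rightarrow> real" where
  "weight \<nu> t l k = rho (real k + \<nu> + 1) (l * t) * (l ^ k / fact k)"

definition orthonormal_polys :: "(nat \<Rightarrow> real) \<Rightarrow> (nat \<Rightarrow> real poly) \<Rightarrow> bool" where
  "orthonormal_polys w P \<longleftrightarrow>
     (\<forall>n. degree (P n) = n) \<and>
     (\<forall>n m. (\<lambda>k. poly (P n) (real k) * poly (P m) (real k) * w k)
               sums (if n = m then 1 else 0))"

definition C1_on :: "('a::real_normed_vector) set \<Rightarrow> ('a \<Rightarrow> 'b::real_normed_vector) \<Rightarrow> bool" where
  "C1_on S f \<longleftrightarrow>
     (\<exists>f' :: 'a \<Rightarrow> 'a \<Rightarrow>\<^sub>L 'b.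
        (\<forall>x\<in>S. (f has_derivative blinfun_apply (f' x)) (at x)) \<and> continuous_on S f')"

text \<open>For a sequence with \<open>degree (P n) = n\<close>, \<open>alpha_coeff\<close> and \<open>beta_coeff\<close> are the coefficients of
  \<open>x ^ n\<close> and \<open>x ^ (n - 1)\<close>, and \<open>rec_q\<close>, \<open>rec_h\<close> are the coefficients in
  \<open>x P n = rec_q P (n + 1) P (n + 1) + rec_h P n P n + rec_q P n P (n - 1)\<close>.\<close>

definition alpha_coeff :: "(nat \<Rightarrow> real poly) \<Rightarrow> nat \<Rightarrow> real" where
  "alpha_coeff P n = coeff (P n) n"

definition beta_coeff :: "(nat \<Rightarrow> real poly) \<Rightarrow> nat \<Rightarrow> real" where
  "beta_coeff P n = (if n = 0 then 0 else coeff (P n) (n - 1))"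

definition rec_q :: "(nat \<Rightarrow> real poly) \<Rightarrow> nat \<Rightarrow> real" where
  "rec_q P n = (if n = 0 then 0 else alpha_coeff P (n - 1) / alpha_coeff P n)"

definition rec_h :: "(nat \<Rightarrow> real poly) \<Rightarrow> nat \<Rightarrow> real" where
  "rec_h P n = beta_coeff P n / alpha_coeff P n - beta_coeff P (n + 1) / alpha_coeff P (n + 1)"

definition prev_poly :: "(nat \<Rightarrow> real poly) \<Rightarrow> nat \<Rightarrow> real poly" where
  "prev_poly P n = (if n = 0 then 0 else P (n - 1))"

end

theory Submission
  imports Defs
begin

text \<open>
  Everything rests on one observation: the Bessel factor of the weight depends on \<open>(t, \<lambda>)\<close> only through
  the product \<open>\<lambda> t\<close>, so it is constant along the hyperbola \<open>r \<mapsto> (c / r, r)\<close> with \<open>c = \<lambda> t\<close>. On that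
  curve the weight is \<open>a k * r ^ k\<close> with \<open>a\<close> independent of \<open>r\<close> (\<open>weight_on_hyperbola\<close>), and
  \<open>t \<partial>\<^sub>t - \<lambda> \<partial>\<^sub>\<lambda>\<close> becomes the derivation \<open>- r d/dr\<close> (\<open>C1_on_partials\<close>). The theorem is thus an instance
  of the Toda deformation equation, which describes how orthonormal polynomials move when an arbitrary
  discrete weight is modulated exponentially.

  Write \<open>L\<^sub>r p = (\<Sum>k. p(k) a\<^sub>k r\<^sup>k)\<close>. As a power series in \<open>r\<close> it satisfies
  \<open>r d/dr L\<^sub>r p = L\<^sub>r (x p)\<close> (\<open>wfun_has_derivative\<close>). Applying \<open>D = - r d/dr\<close> to
  \<open>L\<^sub>r (P\<^sub>n P\<^sub>m) = \<delta>\<^sub>n\<^sub>m\<close> yields \<open>L (DP\<^sub>n P\<^sub>m) + L (P\<^sub>n DP\<^sub>m) = L (x P\<^sub>n P\<^sub>m)\<close>. For \<open>m < n\<close> the second term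
  vanishes because \<open>DP\<^sub>m\<close> has degree at most \<open>m\<close>; for \<open>m = n\<close> the two terms agree. By the three-term
  recurrence the right-hand side is \<open>h\<^sub>n\<close>, \<open>q\<^sub>n\<close> or \<open>0\<close> according as \<open>m = n\<close>, \<open>m = n - 1\<close> or \<open>m < n - 1\<close>
  (\<open>L_x_diag\<close>, \<open>L_x_subdiag\<close>, \<open>L_x_far\<close>). Hence \<open>DP\<^sub>n\<close> and \<open>q\<^sub>n P\<^bsub>n-1\<^esub> + (h\<^sub>n / 2) P\<^sub>n\<close> have the same
  products with all \<open>P\<^sub>m\<close>, \<open>m \<le> n\<close>, and therefore coincide (\<open>eq_0_if_orthogonal\<close>, \<open>toda_deformation\<close>).
\<close>

section \<open>Orthonormal polynomials for a linear functional\<close>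

lemma poly_expand_basis:
  fixes P :: "nat \<Rightarrow> 'a::field poly"
  assumes deg: "\<And>n. degree (P n) = n" and nz: "\<And>n. P n \<noteq> 0"
    and "degree R \<le> N"
  shows "\<exists>c. R = (\<Sum>m\<le>N. smult (c m) (P m))"
  using \<open>degree R \<le> N\<close>
proof (induction N arbitrary: R)
  case 0
  have "R = [:coeff R 0:]" "P 0 = [:coeff (P 0) 0:]"
    using 0 deg[of 0] by (auto elim!: degree_eq_zeroE)
  moreover have "coeff (P 0) 0 \<noteq> 0" using nz[of 0] deg[of 0] leading_coeff_0_iff by metis
  ultimately have "R = smult (coeff R 0 / coeff (P 0) 0) (P 0)"
    by (metis nonzero_eq_divide_eq smult_pCons smult_0_right)
  then show ?case by (intro exI[of _ "\<lambda>_. coeff R 0 / coeff (P 0) 0"]) simp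
next
  case (Suc N)
  define b where "b = coeff R (Suc N) / coeff (P (Suc N)) (Suc N)"
  have lc: "coeff (P (Suc N)) (Suc N) \<noteq> 0"
    using nz[of "Suc N"] deg[of "Suc N"] leading_coeff_0_iff by metis
  have "coeff (R - smult b (P (Suc N))) i = 0" if "i > N" for i
  proof (cases "i = Suc N")
    case True
    then show ?thesis using lc by (simp add: b_def)
  next
    case False
    then have "i > Suc N" using that by simp
    then show ?thesis using Suc.prems deg[of "Suc N"] by (simp add: coeff_eq_0)
  qed
  then have "degree (R - smult b (P (Suc N))) \<le> N" by (intro degree_le) auto
  from Suc.IH[OF this] obtain c where c: "R - smult b (P (Suc N)) = (\<Sum>m\<le>N. smult (c m) (P m))" ..
  have "R = (\<Sum>m\<le>Suc N. smult ((c(Suc N := b)) m) (P m))"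
    using c by (simp add: algebra_simps)
  then show ?case by blast
qed

locale orthonormal_functional =
  fixes L :: "real poly \<Rightarrow> real" and P :: "nat \<Rightarrow> real poly"
  assumes L_add: "L (p + q) = L p + L q"
    and L_smult: "L (smult c p) = c * L p"
    and deg: "degree (P n) = n"
    and ortho: "L (P n * P m) = (if n = m then 1 else 0)"
begin

lemma L_0: "L 0 = 0"
  using L_smult[of 0 0] by simp

lemma L_diff: "L (p - q) = L p - L q"
  using L_add[of "p - q" q] by simp

lemma L_sum: "L (sum f A) = (\<Sum>i\<in>A. L (f i))"
  by (induction A rule: infinite_finite_induct) (auto simp: L_0 L_add)

lemma P_nz: "P n \<noteq> 0"
  using ortho[of n n] L_0 by auto

lemma alpha_nz: "alpha_coeff P n \<noteq> 0"
  using P_nz[of n] deg[of n] unfolding alpha_coeff_def by (metis leading_coeff_0_iff)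

lemma orthogonal_lower_degree:
  assumes "degree R < n"
  shows "L (R * P n) = 0"
proof -
  obtain c where c: "R = (\<Sum>m\<le>degree R. smult (c m) (P m))"
    using poly_expand_basis[of P R "degree R"] deg P_nz by auto
  have "L (R * P n) = (\<Sum>m\<le>degree R. c m * L (P m * P n))"
    by (subst c) (simp add: sum_distrib_right L_sum L_smult)
  also have "\<dots> = 0" using assms by (intro sum.neutral) (auto simp: ortho)
  finally show ?thesis .
qed

text \<open>The coefficients in the expansion of \<open>R\<close> in the basis \<open>P\<close> are recovered as
  \<open>L (R * P m)\<close>.\<close>

lemma eq_0_if_orthogonal:
  assumes "degree R \<le> N" and orth: "\<And>m. m \<le> N \<Longrightarrow> L (R * P m) = 0"
  shows "R = 0"
proof -
  obtain c where c: "R = (\<Sum>m\<le>N. smult (c m) (P m))"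
    using poly_expand_basis[of P R N] deg P_nz assms(1) by auto
  have "c j = 0" if "j \<le> N" for j
  proof -
    have "L (R * P j) = (\<Sum>m\<le>N. c m * L (P m * P j))"
      by (subst c) (simp add: sum_distrib_right L_sum L_smult)
    also have "\<dots> = (\<Sum>m\<le>N. if m = j then c m else 0)"
      by (intro sum.cong) (auto simp: ortho)
    also have "\<dots> = c j" using that by simp
    finally show ?thesis using orth[OF that] by simp
  qed
  then show ?thesis using c by simp
qed

lemma L_x_far:
  assumes "Suc m < n"
  shows "L (pCons 0 (P n * P m)) = 0"
proof -
  have "degree (pCons 0 (P m)) < n"
    using assms deg[of m] degree_pCons_le[of 0 "P m"] by simp
  then have "L (pCons 0 (P m) * P n) = 0" by (rule orthogonal_lower_degree)
  then show ?thesis by (simp add: mult.commute)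
qed

text \<open>Matching leading coefficients, \<open>x P\<^sub>m - q P\<^bsub>m+1\<^esub>\<close> has degree at most \<open>m\<close>, hence is orthogonal
  to \<open>P\<^bsub>m+1\<^esub>\<close>.\<close>

lemma L_x_subdiag: "L (pCons 0 (P (Suc m) * P m)) = rec_q P (Suc m)"
proof -
  define R where "R = pCons 0 (P m) - smult (rec_q P (Suc m)) (P (Suc m))"
  have "coeff R i = 0" if "i > m" for i
  proof (cases "i = Suc m")
    case True
    then show ?thesis using alpha_nz[of "Suc m"]
      by (simp add: R_def rec_q_def alpha_coeff_def)
  next
    case False
    then obtain j where "i = Suc j" "j > m" using \<open>i > m\<close> by (cases i) auto
    then show ?thesis using deg[of m] deg[of "Suc m"] by (simp add: R_def coeff_eq_0)
  qed
  then have "degree R < Suc m" by (intro le_imp_less_Suc degree_le) auto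
  then have "L (R * P (Suc m)) = 0" by (rule orthogonal_lower_degree)
  moreover have "R * P (Suc m) = pCons 0 (P (Suc m) * P m)
      - smult (rec_q P (Suc m)) (P (Suc m) * P (Suc m))"
    by (simp add: R_def left_diff_distrib mult.commute[of "P m"])
  ultimately show ?thesis by (simp add: L_diff L_smult ortho)
qed

text \<open>Matching the two leading coefficients, \<open>x P\<^sub>n - q P\<^bsub>n+1\<^esub> - h P\<^sub>n\<close> is zero or has degree
  below \<open>n\<close>. The zero case is separate because for \<open>n = 0\<close> no degree is below \<open>n\<close>.\<close>

lemma L_x_diag: "L (pCons 0 (P n * P n)) = rec_h P n"
proof -
  define R where "R = pCons 0 (P n) - smult (rec_q P (Suc n)) (P (Suc n)) - smult (rec_h P n) (P n)"
  have top: "coeff R i = 0" if "i \<ge> n" for i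
  proof -
    consider "i = n" | "i = Suc n" | j where "i = Suc j" "j > n"
      using \<open>i \<ge> n\<close> by (cases "i = n"; cases i) force+
    then show ?thesis
    proof cases
      case 1
      have "coeff (pCons 0 (P n)) n = beta_coeff P n"
        by (cases n) (simp_all add: beta_coeff_def)
      then show ?thesis using 1 alpha_nz[of n] alpha_nz[of "Suc n"]
        by (simp add: R_def rec_q_def rec_h_def alpha_coeff_def beta_coeff_def[of P "Suc n"]
            field_simps)
    next
      case 2
      then show ?thesis using alpha_nz[of "Suc n"] deg[of n]
        by (simp add: R_def rec_q_def alpha_coeff_def coeff_eq_0)
    next
      case 3
      then show ?thesis using deg[of n] deg[of "Suc n"] by (simp add: R_def coeff_eq_0)
    qed
  qed
  have "L (R * P n) = 0"
  proof (cases "R = 0")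
    case False
    then have "coeff R (degree R) \<noteq> 0" by simp
    then have "degree R < n" using top not_le by blast
    then show ?thesis by (rule orthogonal_lower_degree)
  qed (simp add: L_0)
  moreover have "R * P n = pCons 0 (P n * P n)
      - smult (rec_q P (Suc n)) (P (Suc n) * P n) - smult (rec_h P n) (P n * P n)"
    by (simp add: R_def left_diff_distrib)
  ultimately show ?thesis by (simp add: L_diff L_smult ortho)
qed

end

section \<open>The functional of a geometrically modulated weight\<close>

definition wfun :: "(nat \<Rightarrow> real) \<Rightarrow> real \<Rightarrow> real poly \<Rightarrow> real" where
  "wfun a r p = (\<Sum>k. poly p (real k) * a k * r ^ k)"

text \<open>Orthonormality asserts convergence only for the products \<open>P n * P m\<close>; those with \<open>n = 0\<close>
  already span all polynomials.\<close>

lemma orthonormal_polys_summable: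
  assumes "orthonormal_polys w P"
  shows "summable (\<lambda>k. poly p (real k) * w k)"
proof -
  have deg: "degree (P n) = n" for n using assms by (simp add: orthonormal_polys_def)
  have sums: "(\<lambda>k. poly (P n) (real k) * poly (P m) (real k) * w k) sums (if n = m then 1 else 0)"
    for n m using assms by (simp add: orthonormal_polys_def)
  have nz: "P n \<noteq> 0" for n
  proof
    assume "P n = 0"
    with sums[of n n] have "(\<lambda>k. 0 :: real) sums 1" by simp
    then show False using sums_unique2[OF sums_zero] by force
  qed
  obtain c where c: "p = (\<Sum>m\<le>degree p. smult (c m) (P m))"
    using poly_expand_basis[of P p "degree p"] deg nz by auto
  obtain d where d: "P 0 = [:d:]" using deg[of 0] by (auto elim: degree_eq_zeroE)
  have "d \<noteq> 0" using d nz[of 0] by auto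
  have "summable (\<lambda>k. (c m / d) * (poly (P 0) (real k) * poly (P m) (real k) * w k))" for m
    by (intro summable_mult sums_summable[OF sums])
  then have *: "summable (\<lambda>k. c m * poly (P m) (real k) * w k)" for m
    using \<open>d \<noteq> 0\<close> by (simp add: d mult.assoc)
  have "poly p y = (\<Sum>m\<le>degree p. c m * poly (P m) y)" for y
    by (subst c) (simp add: poly_sum)
  then show ?thesis
    using summable_sum[of "{..degree p}", OF *] by (simp add: sum_distrib_right)
qed

locale modulated_weight =
  fixes a :: "nat \<Rightarrow> real"
  assumes summ: "0 < r \<Longrightarrow> r < 1 \<Longrightarrow> summable (\<lambda>k. poly p (real k) * a k * r ^ k)"
begin

lemma wfun_add: "0 < r \<Longrightarrow> r < 1 \<Longrightarrow> wfun a r (p + q) = wfun a r p + wfun a r q"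
  unfolding wfun_def by (subst suminf_add) (simp_all add: summ distrib_right)

lemma wfun_smult: "0 < r \<Longrightarrow> r < 1 \<Longrightarrow> wfun a r (smult c p) = c * wfun a r p"
  unfolding wfun_def
  by (subst suminf_mult[symmetric]) (simp_all add: summ mult.assoc[of c])

lemma wfun_0: "wfun a r 0 = 0"
  by (simp add: wfun_def)

lemma wfun_sum:
  assumes "0 < r" "r < 1"
  shows "wfun a r (sum f A) = (\<Sum>i\<in>A. wfun a r (f i))"
  by (induction A rule: infinite_finite_induct) (auto simp: wfun_0 wfun_add assms)

text \<open>Termwise, \<open>r d/dr\<close> multiplies the \<open>k\<close>-th summand by \<open>k\<close>, which is multiplication of the
  polynomial by \<open>x\<close>.\<close>

lemma wfun_has_derivative:
  assumes r: "0 < r" "r < 1"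
  shows "((\<lambda>r. wfun a r p) has_real_derivative wfun a r (pCons 0 p) / r) (at r)"
proof -
  define c where "c k = poly p (real k) * a k" for k
  define K where "K = (r + 1) / 2"
  have K: "r < K" "K < 1" "0 < K" using r by (auto simp: K_def)
  have sK: "summable (\<lambda>k. c k * K ^ k)" using summ[of K p] K by (simp add: c_def)
  have D: "((\<lambda>x. \<Sum>k. c k * x ^ k) has_real_derivative (\<Sum>k. diffs c k * r ^ k)) (at r)"
    using termdiffs_strong[OF sK, of r] r K by simp
  have "summable (\<lambda>k. diffs c k * r ^ k)"
  proof (rule termdiff_converges[of r K])
    show "norm r < K" using r K by simp
    fix x :: real assume "norm x < K"
    then show "summable (\<lambda>k. c k * x ^ k)" using powser_inside[OF sK] K by simp
  qed
  then have "(\<lambda>k. real k * c k * r ^ (k - Suc 0)) sums (\<Sum>k. diffs c k * r ^ k)"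
    by (rule diffs_equiv)
  from sums_mult[OF this, of r]
  have "(\<lambda>k. r * (real k * c k * r ^ (k - Suc 0))) sums (r * (\<Sum>k. diffs c k * r ^ k))" .
  moreover have "r * (real k * c k * r ^ (k - Suc 0)) = poly (pCons 0 p) (real k) * a k * r ^ k" for k
    by (cases k) (auto simp: c_def)
  ultimately have "wfun a r (pCons 0 p) = r * (\<Sum>k. diffs c k * r ^ k)"
    unfolding wfun_def by (simp add: sums_iff)
  then show ?thesis using D r by (simp add: wfun_def c_def)
qed

lemma wfun_coeffs:
  assumes r: "0 < r" "r < 1" and "degree p \<le> N"
  shows "wfun a r p = (\<Sum>i\<le>N. coeff p i * wfun a r (monom 1 i))"
proof -
  have "p = (\<Sum>i\<le>N. smult (coeff p i) (monom 1 i))"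
    using poly_as_sum_of_monoms'[OF assms(3)] by (simp add: smult_monom)
  then have "wfun a r p = wfun a r (\<Sum>i\<le>N. smult (coeff p i) (monom 1 i))" by simp
  also have "\<dots> = (\<Sum>i\<le>N. coeff p i * wfun a r (monom 1 i))"
    by (simp add: wfun_sum[OF r] wfun_smult[OF r])
  finally show ?thesis .
qed

text \<open>Product rule for a polynomial that varies with \<open>r\<close>. Expanding in monomials reduces it to finitely
  many coefficients times moments, so no further interchange of limit and series is required.\<close>

lemma wfun_moving_has_derivative:
  fixes P :: "real \<Rightarrow> real poly"
  assumes r: "0 < r" "r < 1"
    and deg: "\<And>x. 0 < x \<Longrightarrow> x < 1 \<Longrightarrow> degree (P x) \<le> N" and deg': "degree P' \<le> N"
    and D: "\<And>i. ((\<lambda>x. coeff (P x) i) has_real_derivative coeff P' i) (at r)"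
  shows "((\<lambda>x. wfun a x (P x)) has_real_derivative
           wfun a r P' + wfun a r (pCons 0 (P r)) / r) (at r)"
proof -
  have "((\<lambda>x. \<Sum>i\<le>N. coeff (P x) i * wfun a x (monom 1 i)) has_real_derivative
      (\<Sum>i\<le>N. coeff P' i * wfun a r (monom 1 i)
        + (wfun a r (pCons 0 (monom 1 i)) / r) * coeff (P r) i)) (at r)"
    by (intro DERIV_sum DERIV_mult D wfun_has_derivative r)
  also have "(\<Sum>i\<le>N. coeff P' i * wfun a r (monom 1 i)
        + (wfun a r (pCons 0 (monom 1 i)) / r) * coeff (P r) i)
      = wfun a r P' + (\<Sum>i\<le>N. coeff (P r) i * wfun a r (pCons 0 (monom 1 i))) / r"
    by (simp add: wfun_coeffs[OF r deg'] sum.distrib sum_divide_distrib mult.commute)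
  also have "(\<Sum>i\<le>N. coeff (P r) i * wfun a r (pCons 0 (monom 1 i))) = wfun a r (pCons 0 (P r))"
  proof -
    have "pCons 0 (P r) = [:0, 1:] * (\<Sum>i\<le>N. monom (coeff (P r) i) i)"
      by (simp add: poly_as_sum_of_monoms'[OF deg[OF r]])
    also have "\<dots> = (\<Sum>i\<le>N. smult (coeff (P r) i) (pCons 0 (monom 1 i)))"
      by (simp add: sum_distrib_left smult_monom)
    finally show ?thesis by (simp add: wfun_sum[OF r] wfun_smult[OF r] del: smult_pCons)
  qed
  finally show ?thesis
  proof (rule has_field_derivative_transform_within_open[where S = "{0<..<1}"])
    fix x :: real assume "x \<in> {0<..<1}"
    then show "(\<Sum>i\<le>N. coeff (P x) i * wfun a x (monom 1 i)) = wfun a x (P x)"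
      using wfun_coeffs[of x "P x" N] deg[of x] by simp
  qed (use r in auto)
qed

end

lemma coeff_mult_has_derivative:
  assumes "\<And>i. ((\<lambda>x. coeff (p x) i) has_real_derivative coeff p' i) (at r)"
    and "\<And>i. ((\<lambda>x. coeff (q x) i) has_real_derivative coeff q' i) (at r)"
  shows "((\<lambda>x. coeff (p x * q x) i) has_real_derivative coeff (p' * q r + p r * q') i) (at r)"
proof -
  have "((\<lambda>x. \<Sum>j\<le>i. coeff (p x) j * coeff (q x) (i - j)) has_real_derivative
      (\<Sum>j\<le>i. coeff p' j * coeff (q r) (i - j) + coeff q' (i - j) * coeff (p r) j)) (at r)"
    by (intro DERIV_sum DERIV_mult assms)
  then show ?thesis
    by (simp add: coeff_mult sum.distrib mult.commute[of "coeff q' _"])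
qed

section \<open>The Toda deformation equation\<close>

text \<open>Differentiating the orthonormality relations at \<open>r = l\<close> (the fact \<open>rel\<close> in the proof) determines
  the product of \<open>D n\<close> with every \<open>P m l\<close>, \<open>m \<le> n\<close>, and a polynomial of degree at most \<open>n\<close> is
  determined by these products.\<close>

lemma toda_deformation:
  fixes P :: "nat \<Rightarrow> real \<Rightarrow> real poly" and D :: "nat \<Rightarrow> real poly"
  assumes l: "0 < l" "l < 1"
    and ON: "\<And>r. 0 < r \<Longrightarrow> r < 1 \<Longrightarrow> orthonormal_polys (\<lambda>k. a k * r ^ k) (\<lambda>m. P m r)"
    and D: "\<And>m i. ((\<lambda>r. coeff (P m r) i) has_real_derivative coeff (D m) i) (at l)"
    and degD: "\<And>m. degree (D m) \<le> m"
  defines "p \<equiv> \<lambda>m. P m l"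
  shows "smult (- l) (D n) = smult (rec_q p n) (prev_poly p n) + smult (rec_h p n / 2) (p n)"
proof -
  interpret modulated_weight a
  proof
    fix r :: real and p assume "0 < r" "r < 1"
    from orthonormal_polys_summable[OF ON[OF this], of p]
    show "summable (\<lambda>k. poly p (real k) * a k * r ^ k)" by (simp add: mult.assoc)
  qed
  have degP: "degree (P m r) = m" if "0 < r" "r < 1" for m r
    using ON[OF that] by (simp add: orthonormal_polys_def)
  have on: "wfun a r (P i r * P j r) = (if i = j then 1 else 0)" if "0 < r" "r < 1" for i j r
  proof -
    have "(\<lambda>k. poly (P i r) (real k) * poly (P j r) (real k) * (a k * r ^ k))
        sums (if i = j then 1 else 0)"
      using ON[OF that] by (simp add: orthonormal_polys_def)
    then show ?thesis unfolding wfun_def by (simp add: sums_iff mult.assoc)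
  qed
  interpret orthonormal_functional "wfun a l" p
    by unfold_locales (auto simp: wfun_add wfun_smult l degP on p_def)
  have rel: "wfun a l (D i * p j) + wfun a l (D j * p i) + wfun a l (pCons 0 (p i * p j)) / l = 0"
    for i j
  proof -
    have "((\<lambda>r. wfun a r (P i r * P j r)) has_real_derivative
        wfun a l (D i * P j l + P i l * D j) + wfun a l (pCons 0 (P i l * P j l)) / l) (at l)"
    proof (rule wfun_moving_has_derivative[where N = "i + j", OF l])
      show "degree (P i x * P j x) \<le> i + j" if "0 < x" "x < 1" for x
        using degree_mult_le[of "P i x" "P j x"] degP[OF that] by simp
      have "degree (D i * P j l) \<le> i + j"
        using degree_mult_le[of "D i" "P j l"] degD[of i] degP[OF l, of j] by simp
      moreover have "degree (P i l * D j) \<le> i + j"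
        using degree_mult_le[of "P i l" "D j"] degD[of j] degP[OF l, of i] by simp
      ultimately show "degree (D i * P j l + P i l * D j) \<le> i + j" by (rule degree_add_le)
    qed (rule coeff_mult_has_derivative[OF D D])
    moreover have "((\<lambda>r. wfun a r (P i r * P j r)) has_real_derivative 0) (at l)"
      by (rule has_field_derivative_transform_within_open[where S = "{0<..<1}"
            and f = "\<lambda>_. if i = j then 1 else 0"]) (use l on in auto)
    ultimately have "wfun a l (D i * P j l + P i l * D j) + wfun a l (pCons 0 (P i l * P j l)) / l = 0"
      by (rule DERIV_unique)
    then show ?thesis by (simp add: p_def L_add mult.commute)
  qed
  define R where "R = smult (- l) (D n) - smult (rec_q p n) (prev_poly p n) - smult (rec_h p n / 2) (p n)"
  have "R = 0"
  proof (rule eq_0_if_orthogonal)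
    have "degree (prev_poly p n) \<le> n" by (simp add: prev_poly_def deg)
    then show "degree R \<le> n" unfolding R_def
      by (intro degree_diff_le order.trans[OF degree_smult_le]) (use degD deg in auto)
    fix m assume m: "m \<le> n"
    have prev: "rec_q p n * wfun a l (prev_poly p n * p m) = (if Suc m = n then rec_q p n else 0)"
      by (cases n) (auto simp: prev_poly_def ortho rec_q_def)
    have LR: "wfun a l (R * p m) = - l * wfun a l (D n * p m)
        - (if Suc m = n then rec_q p n else 0)
        - rec_h p n / 2 * (if n = m then 1 else 0)"
      by (simp only: R_def left_diff_distrib mult_smult_left L_diff L_smult ortho prev)
    have rel': "- l * wfun a l (D n * p m) = l * wfun a l (D m * p n) + wfun a l (pCons 0 (p n * p m))"
      using rel[of n m] l by (simp add: field_simps)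
    consider "m = n" | "m < n" "Suc m = n" | "m < n" "Suc m < n" using m by linarith
    then show "wfun a l (R * p m) = 0"
    proof cases
      case 1
      then show ?thesis using LR rel' L_x_diag[of n] by simp
    next
      case 2
      have "wfun a l (D m * p n) = 0"
        by (rule orthogonal_lower_degree) (use degD[of m] 2 in simp)
      then show ?thesis using LR rel' L_x_subdiag[of m] 2 by auto
    next
      case 3
      have "wfun a l (D m * p n) = 0"
        by (rule orthogonal_lower_degree) (use degD[of m] 3 in simp)
      then show ?thesis using LR rel' L_x_far[of m n] 3 by simp
    qed
  qed
  then show ?thesis by (simp add: R_def algebra_simps)
qed

section \<open>Reduction to the hyperbola\<close>

lemma weight_on_hyperbola:
  assumes "r \<noteq> 0"
  shows "weight \<nu> (c / r) r k = (rho (real k + \<nu> + 1) c / fact k) * r ^ k"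
  using assms by (simp add: weight_def)

text \<open>The third claim is the chain rule along \<open>r \<mapsto> (t l / r, r)\<close>, whose velocity at \<open>r = l\<close>
  is \<open>(- t / l, 1)\<close>.\<close>

lemma C1_on_partials:
  fixes F :: "real \<Rightarrow> real \<Rightarrow> real"
  assumes "C1_on ({0<..} \<times> {0<..<1}) (\<lambda>(s, r). F s r)" and t: "t > 0" and l: "0 < l" "l < 1"
  defines "u \<equiv> deriv (\<lambda>s. F s l) t" and "v \<equiv> deriv (\<lambda>r. F t r) l"
  shows "((\<lambda>s. F s l) has_real_derivative u) (at t)"
    and "((\<lambda>r. F t r) has_real_derivative v) (at l)"
    and "((\<lambda>r. F (t * l / r) r) has_real_derivative (v - t / l * u)) (at l)"
proof -
  obtain A where A: "((\<lambda>(s, r). F s r) has_derivative blinfun_apply A) (at (t, l))"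
    using assms unfolding C1_on_def by fastforce
  have chain: "((\<lambda>z. F (f z) (g z)) has_real_derivative blinfun_apply A (f', g')) (at z)"
    if f: "(f has_real_derivative f') (at z)" and g: "(g has_real_derivative g') (at z)"
      and "f z = t" "g z = l" for f g f' g' z
  proof -
    have "((\<lambda>z. (f z, g z)) has_derivative (\<lambda>h. (f' * h, g' * h))) (at z)"
      using f g unfolding has_field_derivative_def by (rule has_derivative_Pair)
    moreover have "((\<lambda>(s, r). F s r) has_derivative blinfun_apply A) (at (f z, g z))"
      using A that by simp
    ultimately have "((\<lambda>z. case (f z, g z) of (s, r) \<Rightarrow> F s r) has_derivative
        (\<lambda>h. blinfun_apply A (f' * h, g' * h))) (at z)"
      by (rule has_derivative_compose)
    moreover have "(f' * h, g' * h) = h *\<^sub>R (f', g')" for h by simp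
    ultimately show ?thesis
      unfolding has_field_derivative_def by (simp add: blinfun.scaleR_right mult.commute[of _ "blinfun_apply A _"] del: scaleR_Pair)
  qed
  have Du: "((\<lambda>s. F s l) has_real_derivative blinfun_apply A (1, 0)) (at t)"
    by (rule chain) (auto intro!: derivative_eq_intros)
  have Dv: "((\<lambda>r. F t r) has_real_derivative blinfun_apply A (0, 1)) (at l)"
    by (rule chain) (auto intro!: derivative_eq_intros)
  have uv: "u = blinfun_apply A (1, 0)" "v = blinfun_apply A (0, 1)"
    unfolding u_def v_def using Du Dv by (auto intro: DERIV_imp_deriv)
  show "((\<lambda>s. F s l) has_real_derivative u) (at t)" "((\<lambda>r. F t r) has_real_derivative v) (at l)"
    using Du Dv by (simp_all only: uv)
  have "((\<lambda>r. F (t * l / r) r) has_real_derivative blinfun_apply A (- t / l, 1)) (at l)"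
    by (rule chain) (use l in \<open>auto intro!: derivative_eq_intros simp: field_simps\<close>)
  moreover have "(- t / l, 1) = (0, 1) - (t / l) *\<^sub>R (1::real, 0::real)" by simp
  ultimately show "((\<lambda>r. F (t * l / r) r) has_real_derivative (v - t / l * u)) (at l)"
    by (simp only: uv blinfun.diff_right blinfun.scaleR_right real_scaleR_def)
qed

lemma poly_has_derivative_coeffs:
  fixes P :: "real \<Rightarrow> real poly"
  assumes "open S" "z \<in> S" and deg: "\<And>y. y \<in> S \<Longrightarrow> degree (P y) \<le> n"
    and D: "\<And>i. ((\<lambda>y. coeff (P y) i) has_real_derivative d i) (at z)"
  shows "((\<lambda>y. poly (P y) x) has_real_derivative (\<Sum>i\<le>n. d i * x ^ i)) (at z)"
proof (rule has_field_derivative_transform_within_open[OF _ assms(1,2)])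
  show "((\<lambda>y. \<Sum>i\<le>n. coeff (P y) i * x ^ i) has_real_derivative (\<Sum>i\<le>n. d i * x ^ i)) (at z)"
    by (intro DERIV_sum DERIV_cmult_right D)
  fix y assume "y \<in> S"
  then show "(\<Sum>i\<le>n. coeff (P y) i * x ^ i) = poly (P y) x"
    using deg[of y] poly_as_sum_of_monoms'[of "P y" n]
    by (metis (no_types, lifting) poly_monom poly_sum sum.cong)
qed

theorem mainTheorem6:
  fixes \<nu> t l x :: real and n :: nat
    and Q :: "nat \<Rightarrow> real \<Rightarrow> real \<Rightarrow> real poly"
  assumes "\<nu> > -1" and "t > 0" and "0 < l" and "l < 1"
    and orthonormal: "\<And>s r. s > 0 \<Longrightarrow> 0 < r \<Longrightarrow> r < 1 \<Longrightarrow>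
           orthonormal_polys (weight \<nu> s r) (\<lambda>m. Q m s r)"
    and smooth: "\<And>m i. C1_on ({0<..} \<times> {0<..<1}) (\<lambda>(s, r). coeff (Q m s r) i)"
  shows "t * deriv (\<lambda>s. poly (Q n s l) x) t - l * deriv (\<lambda>r. poly (Q n t r) x) l
           - rec_q (\<lambda>m. Q m t l) n * poly (prev_poly (\<lambda>m. Q m t l) n) x
         = rec_h (\<lambda>m. Q m t l) n / 2 * poly (Q n t l) x"
proof -
  note t = \<open>t > 0\<close> and l = \<open>0 < l\<close> \<open>l < 1\<close>
  have deg: "degree (Q m s r) = m" if "s > 0" "0 < r" "r < 1" for m s r
    using orthonormal[OF that] by (simp add: orthonormal_polys_def)
  define u where "u m i = deriv (\<lambda>s. coeff (Q m s l) i) t" for m i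
  define v where "v m i = deriv (\<lambda>r. coeff (Q m t r) i) l" for m i
  note partials = C1_on_partials[where F = "\<lambda>s r. coeff (Q m s r) i" for m i, OF smooth t l,
      folded u_def v_def]
  define P where "P m r = Q m (t * l / r) r" for m r
  define D where "D m = (\<Sum>i\<le>m. monom (v m i - t / l * u m i) i)" for m
  have coeffD: "coeff (D m) i = (if i \<le> m then v m i - t / l * u m i else 0)" for m i
    by (simp add: D_def coeff_sum)
  have Pl: "P m l = Q m t l" for m using l by (simp add: P_def)
  have "smult (- l) (D n) = smult (rec_q (\<lambda>m. P m l) n) (prev_poly (\<lambda>m. P m l) n)
      + smult (rec_h (\<lambda>m. P m l) n / 2) (P n l)"
  proof (rule toda_deformation[OF l, where a = "\<lambda>k. rho (real k + \<nu> + 1) (t * l) / fact k"])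
    fix r :: real assume r: "0 < r" "r < 1"
    have "orthonormal_polys (weight \<nu> (t * l / r) r) (\<lambda>m. P m r)"
      unfolding P_def using orthonormal[of "t * l / r" r] t l r by simp
    moreover have "weight \<nu> (t * l / r) r = (\<lambda>k. rho (real k + \<nu> + 1) (t * l) / fact k * r ^ k)"
      using r by (intro ext weight_on_hyperbola) simp
    ultimately show "orthonormal_polys (\<lambda>k. rho (real k + \<nu> + 1) (t * l) / fact k * r ^ k) (\<lambda>m. P m r)"
      by simp
  next
    fix m i
    show "((\<lambda>r. coeff (P m r) i) has_real_derivative coeff (D m) i) (at l)"
    proof (cases "i \<le> m")
      case True
      then show ?thesis using partials(3)[of m i] by (simp add: P_def coeffD)
    next
      case False
      have "((\<lambda>r. coeff (P m r) i) has_real_derivative 0) (at l)"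
        by (rule has_field_derivative_transform_within_open[where S = "{0<..<1}" and f = "\<lambda>_. 0"])
          (use False t l deg in \<open>auto simp: P_def coeff_eq_0\<close>)
      then show ?thesis using False by (simp add: coeffD)
    qed
  next
    show "degree (D m) \<le> m" for m by (rule degree_le) (simp add: coeffD)
  qed
  then have "poly (smult (- l) (D n)) x = rec_q (\<lambda>m. Q m t l) n * poly (prev_poly (\<lambda>m. Q m t l) n) x
      + rec_h (\<lambda>m. Q m t l) n / 2 * poly (Q n t l) x"
    by (simp add: Pl)
  moreover have "poly (smult (- l) (D n)) x = t * (\<Sum>i\<le>n. u n i * x ^ i) - l * (\<Sum>i\<le>n. v n i * x ^ i)"
  proof -
    have "poly (D n) x = (\<Sum>i\<le>n. (v n i - t / l * u n i) * x ^ i)"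
      by (simp add: D_def poly_sum poly_monom)
    also have "\<dots> = (\<Sum>i\<le>n. v n i * x ^ i) - t / l * (\<Sum>i\<le>n. u n i * x ^ i)"
      by (simp add: left_diff_distrib sum_subtractf sum_distrib_left mult.assoc)
    finally show ?thesis using l by (simp add: field_simps)
  qed
  moreover have "deriv (\<lambda>s. poly (Q n s l) x) t = (\<Sum>i\<le>n. u n i * x ^ i)"
    by (rule DERIV_imp_deriv, rule poly_has_derivative_coeffs[where S = "{0<..}"])
      (use t l deg partials(1) in auto)
  moreover have "deriv (\<lambda>r. poly (Q n t r) x) l = (\<Sum>i\<le>n. v n i * x ^ i)"
    by (rule DERIV_imp_deriv, rule poly_has_derivative_coeffs[where S = "{0<..<1}"])
      (use t l deg partials(2) in auto)
  ultimately show ?thesis by simp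
qed

end
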